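(* The clique number is stable under 2-switch: for every graph $G$ and every 2-switch $\tau$, $|\omega(\tau(G))-\omega(G)|\le 1$.
   Context: Graphs are finite, simple, undirected and labeled. $\omega(G)$ is the maximum order of a complete subgraph of $G$. For vertices $a,b,c,d$, the 2-switch $\tau=\binom{a\ b}{c\ d}$ maps $G$ to $G-ab-cd+ac+bd$ if $ab,cd\in E(G)$, $\{a,b\}\cap\{c,d\}=\varnothing$ and $ac,bd\notin E(G)$, and to $G$ otherwise. *)

theory Defs
  imports "Graph_Theory.Graph_Theory"
begin

text \<open>Finite simple undirected graphs are the loop-free symmetric finite digraphs
  \<^locale>\<open>pair_graph\<close>: an edge \<open>uv\<close> is the pair of arcs \<open>(u,v)\<close>, \<open>(v,u)\<close>.
  The null graph is allowed.\<close>

definition edge :: "'a \<Rightarrow> 'a \<Rightarrow> 'a rel" where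
  "edge u v = {(u, v), (v, u)}"

text \<open>If some label among \<open>a, b, c, d\<close> is not a vertex of \<open>G\<close>, then \<open>ab\<close> or \<open>cd\<close> is not an edge,
  so \<open>G\<close> is left unchanged.\<close>

definition two_switch :: "'a \<Rightarrow> 'a \<Rightarrow> 'a \<Rightarrow> 'a \<Rightarrow> 'a pair_pre_digraph \<Rightarrow> 'a pair_pre_digraph" where
  "two_switch a b c d G =
    (if edge a b \<subseteq> parcs G \<and> edge c d \<subseteq> parcs G \<and> {a, b} \<inter> {c, d} = {} \<and>
        \<not> edge a c \<subseteq> parcs G \<and> \<not> edge b d \<subseteq> parcs G
     then G\<lparr>parcs := (parcs G - edge a b - edge c d) \<union> edge a c \<union> edge b d\<rparr>
     else G)"

definition is_two_switch :: "('a pair_pre_digraph \<Rightarrow> 'a pair_pre_digraph) \<Rightarrow> bool" where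
  "is_two_switch \<tau> \<longleftrightarrow> (\<exists>a b c d. \<tau> = two_switch a b c d)"

text \<open>The empty subgraph is \<open>K\<^sub>0\<close>, so the maximum below is over a nonempty set, and the null graph
  has clique number \<open>0\<close>.\<close>

definition clique_number :: "('a, 'b) pre_digraph \<Rightarrow> nat" where
  "clique_number G = Max {n. \<exists>H. subgraph H G \<and> complete_digraph n H}"

lemma pair_graph_two_switch:
  assumes "pair_graph G"
  shows "pair_graph (two_switch a b c d G)"
proof -
  interpret pair_graph G by fact
  show ?thesis
  proof (cases "two_switch a b c d G = G")
    case False
    then have *: "edge a b \<subseteq> parcs G" "edge c d \<subseteq> parcs G" "{a, b} \<inter> {c, d} = {}"
      and eq: "two_switch a b c d G =
        G\<lparr>parcs := (parcs G - edge a b - edge c d) \<union> edge a c \<union> edge b d\<rparr>"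
      by (auto simp: two_switch_def split: if_splits)
    have v: "a \<in> pverts G" "b \<in> pverts G" "c \<in> pverts G" "d \<in> pverts G"
      using * in_arcsD1 by (auto simp: edge_def)
    have ne: "a \<noteq> c" "b \<noteq> d"
      using * by auto
    have sym: "(v, u) \<in> parcs G" if "(u, v) \<in> parcs G" for u v
      using that by (rule arcs_symmetric)
    show ?thesis unfolding eq
    proof unfold_locales
      fix e assume "e \<in> parcs (G\<lparr>parcs := (parcs G - edge a b - edge c d) \<union> edge a c \<union> edge b d\<rparr>)"
      then have "e \<in> parcs G \<or> e \<in> edge a c \<union> edge b d"
        by auto
      then have "fst e \<in> pverts G \<and> snd e \<in> pverts G \<and> fst e \<noteq> snd e"
        using v ne pair_no_loops arc_fst_in_verts arc_snd_in_verts unfolding edge_def by fastforce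
      then show "fst e \<in> pverts (G\<lparr>parcs := (parcs G - edge a b - edge c d) \<union> edge a c \<union> edge b d\<rparr>)"
        and "snd e \<in> pverts (G\<lparr>parcs := (parcs G - edge a b - edge c d) \<union> edge a c \<union> edge b d\<rparr>)"
        and "fst e \<noteq> snd e"
        by simp_all
    next
      show "symmetric (with_proj (G\<lparr>parcs := (parcs G - edge a b - edge c d) \<union> edge a c \<union> edge b d\<rparr>))"
        unfolding symmetric_def with_proj_simps sym_def edge_def by (simp, blast intro: sym)
    qed (simp_all add: pair_finite_verts pair_finite_arcs edge_def)
  qed (simp add: assms)
qed

end

theory Submission
  imports Defs
begin

text \<open>Deleting the edges \<open>ab\<close> and \<open>cd\<close> from a graph with \<open>ac\<close> not an edge lowers the clique number
  by at most one: no clique contains all of \<open>a, b, c, d\<close>, so at most one of the two edges lies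
  inside a given clique, and dropping an endpoint of that edge leaves a clique. The image of a
  2-switch has the non-edge \<open>ab\<close>, and up to added edges \<open>G\<close> arises from it by deleting \<open>ac\<close> and
  \<open>bd\<close>, so the same bound applies in both directions.\<close>

text \<open>Cliques are vertex sets here, so dropping a vertex is a set difference and no subgraph
  has to be built.\<close>

definition clique :: "'a pair_pre_digraph \<Rightarrow> 'a set \<Rightarrow> bool" where
  "clique G C \<longleftrightarrow> C \<subseteq> pverts G \<and> (\<forall>u\<in>C. \<forall>v\<in>C. u \<noteq> v \<longrightarrow> (u, v) \<in> parcs G)"

lemma cliqueD: "clique G C \<Longrightarrow> u \<in> C \<Longrightarrow> v \<in> C \<Longrightarrow> u \<noteq> v \<Longrightarrow> (u, v) \<in> parcs G"
  by (auto simp: clique_def)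

lemma clique_number_eq_Max_clique:
  assumes "pair_graph G"
  shows "clique_number (with_proj G) = Max (card ` {C. clique G C})"
proof -
  interpret pair_graph G by fact
  have "\<exists>C. clique G C \<and> card C = n" if sub: "subgraph H (with_proj G)" and K: "complete_digraph n H" for H n
  proof (intro exI conjI)
    \<comment> \<open>Compatibility with \<open>with_proj G\<close> forces the projections on
      \<open>H\<close>, so each arc of \<open>H\<close> is its own pair of ends.\<close>
    have "tail H = fst" "head H = snd" "arcs H \<subseteq> parcs G"
      using sub by (auto simp: subgraph_def compatible_def)
    then have "arcs_ends H \<subseteq> parcs G"
      by (auto simp: arcs_ends_def arc_to_ends_def)
    then show "clique G (verts H)"
      using sub K by (auto simp: subgraph_def complete_digraph_def clique_def)
    show "card (verts H) = n"
      using K by (simp add: complete_digraph_def)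
  qed
  moreover have "\<exists>H. subgraph H (with_proj G) \<and> complete_digraph (card C) H" if C: "clique G C" for C
  proof (intro exI conjI)
    let ?H = "\<lparr>pverts = C, parcs = {(u, v). u \<in> C \<and> v \<in> C \<and> u \<noteq> v}\<rparr>"
    have "pair_wf_digraph ?H"
      by unfold_locales auto
    then show "subgraph (with_proj ?H) (with_proj G)"
      using C wf_digraph by (auto simp: subgraph_def compatible_def clique_def wf_digraph_wp_iff)
    show "complete_digraph (card C) (with_proj ?H)"
      using C finite_subset[OF _ pair_finite_verts]
      by (auto simp: complete_digraph_pair_def clique_def)
  qed
  ultimately have "{n. \<exists>H. subgraph H (with_proj G) \<and> complete_digraph n H} = card ` {C. clique G C}"
    by (auto simp: image_iff)
  then show ?thesis
    by (simp add: clique_number_def)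
qed

lemma finite_cliques: "pair_graph G \<Longrightarrow> finite {C. clique G C}"
  by (rule finite_subset[of _ "Pow (pverts G)"])
    (auto simp: clique_def pair_graph_def pair_digraph_def pair_fin_digraph.pair_finite_verts)

lemma card_le_clique_number:
  assumes "pair_graph G" "clique G C"
  shows "card C \<le> clique_number (with_proj G)"
  using assms by (simp add: clique_number_eq_Max_clique finite_cliques)

lemma obtain_max_clique:
  assumes "pair_graph G"
  obtains C where "clique G C" "card C = clique_number (with_proj G)"
proof -
  \<comment> \<open>The empty clique makes the set of sizes nonempty, so its maximum is
    attained.\<close>
  have "clique G {}"
    by (simp add: clique_def)
  then have "clique_number (with_proj G) \<in> card ` {C. clique G C}"
    unfolding clique_number_eq_Max_clique[OF assms]
    by (intro Max_in) (auto simp: finite_cliques[OF assms])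
  then show thesis
    using that by auto
qed

text \<open>The arcs of \<open>H\<close> are bounded only from below, so the edges that a switch
  adds do no harm and either graph of the switch can take the role of \<open>G\<close>.\<close>

lemma clique_number_le_Suc:
  assumes G: "pair_graph G" and H: "pair_graph H"
    and verts: "pverts H = pverts G"
    and arcs: "parcs G - edge a b - edge c d \<subseteq> parcs H"
    and "a \<noteq> c" and nonedge: "\<not> edge a c \<subseteq> parcs G"
  shows "clique_number (with_proj G) \<le> Suc (clique_number (with_proj H))"
proof -
  obtain C where C: "clique G C" and card: "card C = clique_number (with_proj G)"
    using obtain_max_clique[OF G] .
  have "\<not> (a \<in> C \<and> c \<in> C)"
    using cliqueD[OF C] \<open>a \<noteq> c\<close> nonedge by (auto simp: edge_def)
  \<comment> \<open>If \<open>a\<close> is outside \<open>C\<close>, take \<open>x = c\<close>;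
    otherwise \<open>c\<close> is outside \<open>C\<close>, and \<open>x = a\<close> works.\<close>
  then obtain x where x: "\<not> {a, b} \<subseteq> C - {x}" "\<not> {c, d} \<subseteq> C - {x}"
    by blast
  have "clique H (C - {x})"
    unfolding clique_def
  proof (intro conjI ballI impI)
    show "C - {x} \<subseteq> pverts H"
      using C verts by (auto simp: clique_def)
    fix u v assume uv: "u \<in> C - {x}" "v \<in> C - {x}" "u \<noteq> v"
    then have "(u, v) \<in> parcs G"
      using cliqueD[OF C] by blast
    moreover have "(u, v) \<notin> edge a b" "(u, v) \<notin> edge c d"
      using uv x by (auto simp: edge_def)
    ultimately show "(u, v) \<in> parcs H"
      using arcs by blast
  qed
  then have "card (C - {x}) \<le> clique_number (with_proj H)"
    by (rule card_le_clique_number[OF H])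
  \<comment> \<open>The chosen \<open>x\<close> may lie outside \<open>C\<close>; then no vertex is
    lost.\<close>
  then show ?thesis
    using card by (cases "x \<in> C") (auto simp: card_Diff_singleton_if)
qed

theorem theorem14:
  fixes G :: "'a pair_pre_digraph"
    and \<tau> :: "'a pair_pre_digraph \<Rightarrow> 'a pair_pre_digraph"
  assumes "pair_graph G"
    and "is_two_switch \<tau>"
  shows "\<bar>int (clique_number (with_proj (\<tau> G))) - int (clique_number (with_proj G))\<bar> \<le> 1"
proof -
  obtain a b c d where \<tau>: "\<tau> = two_switch a b c d"
    using assms(2) by (auto simp: is_two_switch_def)
  show ?thesis
  proof (cases "\<tau> G = G")
    case False
    then have *: "edge a b \<subseteq> parcs G" "edge c d \<subseteq> parcs G" "{a, b} \<inter> {c, d} = {}"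
        "\<not> edge a c \<subseteq> parcs G"
      and eq: "\<tau> G = G\<lparr>parcs := (parcs G - edge a b - edge c d) \<union> edge a c \<union> edge b d\<rparr>"
      by (auto simp: \<tau> two_switch_def split: if_splits)
    interpret pair_graph G by fact
    \<comment> \<open>Absence of loops gives this; in the reverse direction it replaces
      \<open>a \<noteq> c\<close>.\<close>
    have "a \<noteq> b"
      using *(1) pair_no_loops by (fastforce simp: edge_def)
    have \<tau>G: "pair_graph (\<tau> G)"
      using assms(1) by (simp add: \<tau> pair_graph_two_switch)
    have "clique_number (with_proj G) \<le> Suc (clique_number (with_proj (\<tau> G)))"
      by (rule clique_number_le_Suc[OF assms(1) \<tau>G, of a b c d]) (use * in \<open>auto simp: eq\<close>)
    \<comment> \<open>The reverse direction exchanges \<open>b\<close> and \<open>c\<close>: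
      removing \<open>ac\<close> and \<open>bd\<close> from \<open>\<tau> G\<close> leaves only arcs
      of \<open>G\<close>, and \<open>ab\<close> is now the non-edge.\<close>
    moreover have "\<not> edge a b \<subseteq> parcs (\<tau> G)"
      using * \<open>a \<noteq> b\<close> by (auto simp: eq edge_def)
    then have "clique_number (with_proj (\<tau> G)) \<le> Suc (clique_number (with_proj G))"
      by (intro clique_number_le_Suc[OF \<tau>G assms(1), of a c b d]) (use \<open>a \<noteq> b\<close> in \<open>auto simp: eq\<close>)
    ultimately show ?thesis
      by linarith
  qed simp
qed

end
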